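(* Let $(\boldsymbol{x},\boldsymbol{n},\boldsymbol{s}):U\to\mathbb{R}^3\times\Delta$ be a framed surface with basic invariants $a_i,b_i,e_i,f_i,g_i$ ($i=1,2$). Then $(\boldsymbol{x},\boldsymbol{n},\boldsymbol{s})$ is an $(\boldsymbol{s},\overline{\boldsymbol{t}})$-Bertrand framed surface if and only if there exist smooth functions $\lambda,\widetilde\theta:U\to\mathbb{R}$ with $\lambda\not\equiv0$ such that $$\begin{pmatrix} \lambda(u,v)e_1(u,v) & b_1(u,v)+\lambda(u,v)g_1(u,v)\\ \lambda(u,v)e_2(u,v) & b_2(u,v)+\lambda(u,v)g_2(u,v)\end{pmatrix}\begin{pmatrix}\sin\widetilde\theta(u,v)\\ \cos\widetilde\theta(u,v)\end{pmatrix}=\begin{pmatrix}0\\0\end{pmatrix}$$ for all $(u,v)\in U$.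
   Context: All maps are $C^\infty$. $U\subset\mathbb{R}^2$ is a simply connected domain with coordinates $(u,v)$, $S^2$ is the unit sphere in $\mathbb{R}^3$, and $\Delta=\{(\boldsymbol{a},\boldsymbol{b})\in S^2\times S^2 : \boldsymbol{a}\cdot\boldsymbol{b}=0\}$. A framed surface is a smooth map $(\boldsymbol{x},\boldsymbol{n},\boldsymbol{s}):U\to\mathbb{R}^3\times\Delta$ with $\boldsymbol{x}_u\cdot\boldsymbol{n}=\boldsymbol{x}_v\cdot\boldsymbol{n}=0$ on $U$. Put $\boldsymbol{t}=\boldsymbol{n}\times\boldsymbol{s}$. Its basic invariants are the smooth functions $a_i,b_i,e_i,f_i,g_i:U\to\mathbb{R}$ ($i=1,2$) determined by $\boldsymbol{x}_u=a_1\boldsymbol{s}+b_1\boldsymbol{t}$, $\boldsymbol{n}_u=e_1\boldsymbol{s}+f_1\boldsymbol{t}$, $\boldsymbol{s}_u=-e_1\boldsymbol{n}+g_1\boldsymbol{t}$, $\boldsymbol{t}_u=-f_1\boldsymbol{n}-g_1\boldsymbol{s}$, and the same equations with $\partial_v$ in place of $\partial_u$ and index $2$ in place of $1$. For a smooth $\lambda:U\to\mathbb{R}$, $\lambda\not\equiv0$ means that $\{(u,v)\in U:\lambda(u,v)\neq0\}$ is dense in $U$. Two framed surfaces $(\boldsymbol{x},\boldsymbol{n},\boldsymbol{s}),(\overline{\boldsymbol{x}},\overline{\boldsymbol{n}},\overline{\boldsymbol{s}}):U\to\mathbb{R}^3\times\Delta$ (with $\overline{\boldsymbol{t}}=\overline{\boldsymbol{n}}\times\overline{\boldsymbol{s}}$)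 are $(\boldsymbol{v},\overline{\boldsymbol{w}})$-mates, where each of $\boldsymbol{v},\boldsymbol{w}$ is one of $\boldsymbol{n},\boldsymbol{s},\boldsymbol{t}$, if there is a smooth $\lambda:U\to\mathbb{R}$ with $\lambda\not\equiv0$ such that $\overline{\boldsymbol{x}}=\boldsymbol{x}+\lambda\boldsymbol{v}$ and $\boldsymbol{v}=\overline{\boldsymbol{w}}$ on $U$. $(\boldsymbol{x},\boldsymbol{n},\boldsymbol{s})$ is a $(\boldsymbol{v},\overline{\boldsymbol{w}})$-Bertrand framed surface if there is a framed surface $(\overline{\boldsymbol{x}},\overline{\boldsymbol{n}},\overline{\boldsymbol{s}}):U\to\mathbb{R}^3\times\Delta$ such that the two are $(\boldsymbol{v},\overline{\boldsymbol{w}})$-mates. *)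

theory Defs
  imports "HOL-Analysis.Analysis" "HOL-Analysis.Cross3"
begin

unbundle cross3_syntax

text \<open>
  All maps on a domain \<open>U\<close> are total functions of which only the values on \<open>U\<close> matter; \<open>U\<close> is
  always open in the theorem, so derivatives at points of \<open>U\<close> do not depend on values outside.
\<close>

text \<open>\<open>C\<^sup>k\<close> and \<open>C\<^sup>\<infinity>\<close> maps on an open set, by iterating directional derivatives.\<close>

primrec Ck_on :: "nat \<Rightarrow> 'a::euclidean_space set \<Rightarrow> ('a \<Rightarrow> 'b::real_normed_vector) \<Rightarrow> bool" where
  "Ck_on 0 U f \<longleftrightarrow> continuous_on U f"
| "Ck_on (Suc k) U f \<longleftrightarrow>
     (\<forall>p\<in>U. f differentiable (at p)) \<and>
     (\<forall>d. Ck_on k U (\<lambda>p. frechet_derivative f (at p) d))"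

definition smooth_on :: "'a::euclidean_space set \<Rightarrow> ('a \<Rightarrow> 'b::real_normed_vector) \<Rightarrow> bool" where
  "smooth_on U f \<longleftrightarrow> (\<forall>k. Ck_on k U f)"

text \<open>
  The coordinates are \<open>u = p $ 1\<close> and \<open>v = p $ 2\<close>, so \<open>\<partial> 1\<close> is the partial derivative in \<open>u\<close> and
  \<open>\<partial> 2\<close> the one in \<open>v\<close>. The same index type \<open>2\<close> carries the index \<open>i = 1, 2\<close> of the basic
  invariants.
\<close>

definition partial :: "2 \<Rightarrow> (real^2 \<Rightarrow> 'b::real_normed_vector) \<Rightarrow> real^2 \<Rightarrow> 'b" ("\<partial>") where
  "\<partial> i f p = frechet_derivative f (at p) (axis i 1)"

definition Delta :: "((real^3) \<times> (real^3)) set" where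
  "Delta = {(a, b). a \<in> sphere 0 1 \<and> b \<in> sphere 0 1 \<and> a \<bullet> b = 0}"

definition framed_surface ::
  "(real^2) set \<Rightarrow> (real^2 \<Rightarrow> real^3) \<Rightarrow> (real^2 \<Rightarrow> real^3) \<Rightarrow> (real^2 \<Rightarrow> real^3) \<Rightarrow> bool" where
  "framed_surface U x n s \<longleftrightarrow>
     smooth_on U x \<and> smooth_on U n \<and> smooth_on U s \<and>
     (\<forall>p\<in>U. (n p, s p) \<in> Delta) \<and>
     (\<forall>p\<in>U. \<partial> 1 x p \<bullet> n p = 0 \<and> \<partial> 2 x p \<bullet> n p = 0)"

definition tvec :: "(real^2 \<Rightarrow> real^3) \<Rightarrow> (real^2 \<Rightarrow> real^3) \<Rightarrow> real^2 \<Rightarrow> real^3" where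
  "tvec n s p = n p \<times> s p"

definition basic_invariants ::
  "(real^2) set \<Rightarrow> (real^2 \<Rightarrow> real^3) \<Rightarrow> (real^2 \<Rightarrow> real^3) \<Rightarrow> (real^2 \<Rightarrow> real^3) \<Rightarrow>
   (2 \<Rightarrow> real^2 \<Rightarrow> real) \<Rightarrow> (2 \<Rightarrow> real^2 \<Rightarrow> real) \<Rightarrow> (2 \<Rightarrow> real^2 \<Rightarrow> real) \<Rightarrow>
   (2 \<Rightarrow> real^2 \<Rightarrow> real) \<Rightarrow> (2 \<Rightarrow> real^2 \<Rightarrow> real) \<Rightarrow> bool" where
  "basic_invariants U x n s a b e f g \<longleftrightarrow>
     (\<forall>i. smooth_on U (a i) \<and> smooth_on U (b i) \<and> smooth_on U (e i) \<and>
          smooth_on U (f i) \<and> smooth_on U (g i)) \<and>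
     (\<forall>i. \<forall>p\<in>U.
        \<partial> i x p = a i p *\<^sub>R s p + b i p *\<^sub>R tvec n s p \<and>
        \<partial> i n p = e i p *\<^sub>R s p + f i p *\<^sub>R tvec n s p \<and>
        \<partial> i s p = - e i p *\<^sub>R n p + g i p *\<^sub>R tvec n s p \<and>
        \<partial> i (tvec n s) p = - f i p *\<^sub>R n p - g i p *\<^sub>R s p)"

text \<open>The relation \<open>\<lambda> \<not>\<equiv> 0\<close>, in the strong sense that the nonzero set is dense in \<open>U\<close>.\<close>

definition densely_nonzero_on :: "(real^2) set \<Rightarrow> (real^2 \<Rightarrow> real) \<Rightarrow> bool" where
  "densely_nonzero_on U lam \<longleftrightarrow> U \<subseteq> closure {p\<in>U. lam p \<noteq> 0}"

datatype frame_leg = Leg_n | Leg_s | Leg_t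

primrec leg ::
  "frame_leg \<Rightarrow> (real^2 \<Rightarrow> real^3) \<Rightarrow> (real^2 \<Rightarrow> real^3) \<Rightarrow> real^2 \<Rightarrow> real^3" where
  "leg Leg_n n s = n"
| "leg Leg_s n s = s"
| "leg Leg_t n s = tvec n s"

definition mates ::
  "(real^2) set \<Rightarrow> frame_leg \<Rightarrow> frame_leg \<Rightarrow>
   (real^2 \<Rightarrow> real^3) \<Rightarrow> (real^2 \<Rightarrow> real^3) \<Rightarrow> (real^2 \<Rightarrow> real^3) \<Rightarrow>
   (real^2 \<Rightarrow> real^3) \<Rightarrow> (real^2 \<Rightarrow> real^3) \<Rightarrow> (real^2 \<Rightarrow> real^3) \<Rightarrow> bool" where
  "mates U v w x n s x' n' s' \<longleftrightarrow>
     framed_surface U x n s \<and> framed_surface U x' n' s' \<and>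
     (\<exists>lam. smooth_on U lam \<and> densely_nonzero_on U lam \<and>
        (\<forall>p\<in>U. x' p = x p + lam p *\<^sub>R leg v n s p \<and> leg v n s p = leg w n' s' p))"

definition Bertrand_framed_surface ::
  "(real^2) set \<Rightarrow> frame_leg \<Rightarrow> frame_leg \<Rightarrow>
   (real^2 \<Rightarrow> real^3) \<Rightarrow> (real^2 \<Rightarrow> real^3) \<Rightarrow> (real^2 \<Rightarrow> real^3) \<Rightarrow> bool" where
  "Bertrand_framed_surface U v w x n s \<longleftrightarrow>
     (\<exists>x' n' s'. framed_surface U x' n' s' \<and> mates U v w x n s x' n' s')"

end

theory Submission
  imports Defs
begin

text \<open>
  The idea. Suppose \<open>x' = x + \<lambda> s\<close> and \<open>s = t'\<close>. The new normal \<open>n'\<close> is a unit vector orthogonal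
  to \<open>s\<close>, so it is a rotation of \<open>t\<close> within the plane spanned by \<open>n\<close> and \<open>t\<close>. The structure
  equations give
  \<open>\<partial> i x' = (a\<^sub>i + \<partial> i \<lambda>) s + (b\<^sub>i + \<lambda> g\<^sub>i) t - \<lambda> e\<^sub>i n\<close> (lemma \<open>partial_along_s\<close>),
  hence \<open>n' = cos \<theta> t - sin \<theta> n\<close> is normal to \<open>x'\<close> exactly when
  \<open>\<lambda> e\<^sub>i sin \<theta> + (b\<^sub>i + \<lambda> g\<^sub>i) cos \<theta> = 0\<close> for both \<open>i\<close>, which is the stated linear system.

  From a solution \<open>\<lambda>\<close>, \<open>\<theta>\<close> one therefore writes down the mate explicitly, with
  \<open>s' = cos \<theta> n + sin \<theta> t\<close>. In the other direction a mate only provides the pair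
  \<open>(- n' \<bullet> n, n' \<bullet> t)\<close> on the unit circle. That this pair equals \<open>(sin \<theta>, cos \<theta>)\<close> for one globally
  defined angle is where simple connectedness of \<open>U\<close> enters: it yields a continuous logarithm
  of the pair viewed as a complex number. A continuous angle of a smooth pair \<open>(S, C)\<close> is
  smooth by itself, because locally it is an arcsine of a smooth function, with derivative
  \<open>C dS - S dC\<close> (lemmas \<open>has_derivative_angle\<close> and \<open>smooth_on_angle\<close>).
\<close>

section \<open>Calculus of smooth maps\<close>

text \<open>
  The recursion for \<open>C\<^sup>k\<close> differentiates a function defined on the whole space, yet derivatives at
  points of the open set \<open>U\<close> only see \<open>U\<close>. This is what lets a derivative formula valid on \<open>U\<close> stand
  in for the Frechet derivative in the next lemma, on which the closure properties rest.
\<close>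

lemma Ck_on_cong:
  assumes "open U" "\<And>p. p \<in> U \<Longrightarrow> f p = g p" "Ck_on k U f"
  shows "Ck_on k U g"
  using assms(2,3)
proof (induction k arbitrary: f g)
  case 0
  then show ?case
    by (simp cong: continuous_on_cong)
next
  case (Suc k)
  have transfer: "(g has_derivative frechet_derivative f (at p)) (at p)" if "p \<in> U" for p
    using Suc.prems that
    by (intro has_derivative_transform_within_open[OF frechet_derivative_works[THEN iffD1] assms(1) that])
       auto
  have "Ck_on k U (\<lambda>p. frechet_derivative g (at p) d)" for d
  proof (rule Suc.IH)
    show "frechet_derivative f (at p) d = frechet_derivative g (at p) d" if "p \<in> U" for p
      using frechet_derivative_at[OF transfer[OF that]] by simp
    show "Ck_on k U (\<lambda>p. frechet_derivative f (at p) d)"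
      using Suc.prems by simp
  qed
  then show ?case
    using transfer by (auto simp: differentiable_def)
qed

lemma Ck_on_SucI:
  assumes "open U"
    and "\<And>p. p \<in> U \<Longrightarrow> (f has_derivative f' p) (at p)"
    and "\<And>d. Ck_on k U (\<lambda>p. f' p d)"
  shows "Ck_on (Suc k) U f"
proof -
  have "Ck_on k U (\<lambda>p. frechet_derivative f (at p) d)" for d
    by (rule Ck_on_cong[OF assms(1) _ assms(3)[of d]])
       (simp add: frechet_derivative_at[OF assms(2), symmetric])
  then show ?thesis
    using assms(2) by (auto simp: differentiable_def)
qed

lemma Ck_on_Suc_has_derivative:
  "Ck_on (Suc k) U f \<Longrightarrow> p \<in> U \<Longrightarrow> (f has_derivative frechet_derivative f (at p)) (at p)"
  by (simp add: frechet_derivative_works[THEN iffD1])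

lemma Ck_on_Suc_imp_Ck_on: "Ck_on (Suc k) U f \<Longrightarrow> Ck_on k U f"
proof (induction k arbitrary: f)
  case 0
  then show ?case
    by (auto intro!: continuous_at_imp_continuous_on differentiable_imp_continuous_within)
next
  case (Suc k)
  then show ?case
    unfolding Ck_on.simps(2)[of "Suc k" U f] Ck_on.simps(2)[of k U f] by blast
qed

lemma Ck_on_add:
  assumes "open U" "Ck_on k U f" "Ck_on k U g"
  shows "Ck_on k U (\<lambda>p. f p + g p)"
  using assms(2,3)
proof (induction k arbitrary: f g)
  case 0
  then show ?case by (simp add: continuous_on_add)
next
  case (Suc k)
  show ?case
  proof (rule Ck_on_SucI[OF assms(1)])
    show "((\<lambda>p. f p + g p) has_derivative
        (\<lambda>d. frechet_derivative f (at p) d + frechet_derivative g (at p) d)) (at p)"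
      if "p \<in> U" for p
      using Suc.prems that by (intro has_derivative_add Ck_on_Suc_has_derivative)
  qed (use Suc in auto)
qed

lemma Ck_on_bilinear:
  assumes "bounded_bilinear B" "open U" "Ck_on k U f" "Ck_on k U g"
  shows "Ck_on k U (\<lambda>p. B (f p) (g p))"
  using assms(3,4)
proof (induction k arbitrary: f g)
  case 0
  then show ?case by (simp add: bounded_bilinear.continuous_on[OF assms(1)])
next
  case (Suc k)
  show ?case
  proof (rule Ck_on_SucI[OF assms(2)])
    show "((\<lambda>p. B (f p) (g p)) has_derivative
        (\<lambda>d. B (f p) (frechet_derivative g (at p) d) + B (frechet_derivative f (at p) d) (g p))) (at p)"
      if "p \<in> U" for p
      using Suc.prems that
      by (intro bounded_bilinear.FDERIV[OF assms(1)] Ck_on_Suc_has_derivative)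
    show "Ck_on k U (\<lambda>p. B (f p) (frechet_derivative g (at p) d) + B (frechet_derivative f (at p) d) (g p))"
      for d
      using Suc.prems Suc.prems[THEN Ck_on_Suc_imp_Ck_on]
      by (intro Ck_on_add[OF assms(2)] Suc.IH) auto
  qed
qed

lemma Ck_on_const: "open U \<Longrightarrow> Ck_on k U (\<lambda>p. c)"
proof (induction k arbitrary: c)
  case (Suc k)
  then show ?case by (intro Ck_on_SucI[where f' = "\<lambda>p d. 0"]) auto
qed simp

lemma smooth_on_add:
  "open U \<Longrightarrow> smooth_on U f \<Longrightarrow> smooth_on U g \<Longrightarrow> smooth_on U (\<lambda>p. f p + g p)"
  by (simp add: smooth_on_def Ck_on_add)

lemma smooth_on_bilinear:
  "bounded_bilinear B \<Longrightarrow> open U \<Longrightarrow> smooth_on U f \<Longrightarrow> smooth_on U g \<Longrightarrow>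
    smooth_on U (\<lambda>p. B (f p) (g p))"
  by (simp add: smooth_on_def Ck_on_bilinear)

lemmas smooth_on_scaleR = smooth_on_bilinear[OF bounded_bilinear_scaleR]
lemmas smooth_on_mult = smooth_on_bilinear[OF bounded_bilinear_mult]
lemmas smooth_on_inner = smooth_on_bilinear[OF bounded_bilinear_inner]

lemma smooth_on_minus:
  assumes "open U" "smooth_on U f"
  shows "smooth_on U (\<lambda>p. - f p)"
  using smooth_on_scaleR[OF assms(1) _ assms(2), of "\<lambda>p. -1"] assms(1)
  by (simp add: smooth_on_def Ck_on_const)

lemma smooth_on_diff:
  "open U \<Longrightarrow> smooth_on U f \<Longrightarrow> smooth_on U g \<Longrightarrow> smooth_on U (\<lambda>p. f p - g p)"
  using smooth_on_add[OF _ _ smooth_on_minus, of U f g] by simp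

lemma smooth_on_has_derivative:
  "smooth_on U f \<Longrightarrow> p \<in> U \<Longrightarrow> (f has_derivative frechet_derivative f (at p)) (at p)"
  unfolding smooth_on_def by (blast intro: Ck_on_Suc_has_derivative)

lemma smooth_on_frechet_derivative:
  "smooth_on U f \<Longrightarrow> smooth_on U (\<lambda>p. frechet_derivative f (at p) d)"
  unfolding smooth_on_def by (metis Ck_on.simps(2))

lemma smooth_on_imp_continuous_on: "smooth_on U f \<Longrightarrow> continuous_on U f"
  unfolding smooth_on_def by (metis Ck_on.simps(1))

text \<open>Only differentiability of \<open>f\<close> itself has to be checked, once its directional derivatives
  are recognised as smooth.\<close>

lemma smooth_onI_derivative:
  assumes "open U"
    and "\<And>p. p \<in> U \<Longrightarrow> (f has_derivative f' p) (at p)"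
    and "\<And>d. smooth_on U (\<lambda>p. f' p d)"
  shows "smooth_on U f"
  unfolding smooth_on_def
proof
  fix k
  have "Ck_on (Suc k) U f"
    using assms by (intro Ck_on_SucI) (auto simp: smooth_on_def)
  then show "Ck_on k U f"
    by (rule Ck_on_Suc_imp_Ck_on)
qed

text \<open>Each of sine and cosine is the derivative of the other up to sign, so one induction
  on the order of differentiability has to treat both.\<close>

lemma Ck_on_sin_cos:
  fixes h :: "'a::euclidean_space \<Rightarrow> real"
  assumes "open U" "Ck_on k U h"
  shows "Ck_on k U (\<lambda>p. sin (h p)) \<and> Ck_on k U (\<lambda>p. cos (h p))"
  using assms(2)
proof (induction k)
  case 0
  then show ?case by (auto intro: continuous_intros)
next
  case (Suc k)
  note der = Ck_on_Suc_has_derivative[OF Suc.prems]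
  have IH: "Ck_on k U (\<lambda>p. sin (h p))" "Ck_on k U (\<lambda>p. cos (h p))"
    using Suc.IH Ck_on_Suc_imp_Ck_on[OF Suc.prems] by auto
  have dh: "Ck_on k U (\<lambda>p. frechet_derivative h (at p) d)" for d
    using Suc.prems by simp
  have "Ck_on k U (\<lambda>p. (- 1) * sin (h p))"
    using Ck_on_bilinear[OF bounded_bilinear_mult assms(1) Ck_on_const[OF assms(1)] IH(1)] .
  then have neg: "Ck_on k U (\<lambda>p. - sin (h p))" by simp
  show ?case
  proof
    show "Ck_on (Suc k) U (\<lambda>p. sin (h p))"
    proof (rule Ck_on_SucI[OF assms(1)])
      show "((\<lambda>p. sin (h p)) has_derivative (\<lambda>d. cos (h p) * frechet_derivative h (at p) d)) (at p)"
        if "p \<in> U" for p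
        using has_derivative_sin[OF der[OF that]] by (simp add: mult.commute)
    qed (rule Ck_on_bilinear[OF bounded_bilinear_mult assms(1) IH(2) dh])
    show "Ck_on (Suc k) U (\<lambda>p. cos (h p))"
    proof (rule Ck_on_SucI[OF assms(1)])
      show "((\<lambda>p. cos (h p)) has_derivative (\<lambda>d. - sin (h p) * frechet_derivative h (at p) d)) (at p)"
        if "p \<in> U" for p
        using has_derivative_cos[OF der[OF that]] by (simp add: mult.commute)
    qed (rule Ck_on_bilinear[OF bounded_bilinear_mult assms(1) neg dh])
  qed
qed

lemma smooth_on_sin: "open U \<Longrightarrow> smooth_on U h \<Longrightarrow> smooth_on U (\<lambda>p. sin (h p :: real))"
  and smooth_on_cos: "open U \<Longrightarrow> smooth_on U h \<Longrightarrow> smooth_on U (\<lambda>p. cos (h p :: real))"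
  by (simp_all add: smooth_on_def Ck_on_sin_cos)

section \<open>Smooth angle functions\<close>

text \<open>
  Near \<open>p\<close> the continuous function \<open>\<theta> - \<theta> p\<close> stays within \<open>(- \<pi>/2, \<pi>/2)\<close>, where it is recovered
  from its sine \<open>S q C p - C q S p\<close>; the arcsine has derivative \<open>1\<close> at \<open>0\<close>.
\<close>

lemma has_derivative_angle:
  fixes \<theta> S C :: "'a::euclidean_space \<Rightarrow> real"
  assumes "open U" "p \<in> U" "continuous_on U \<theta>"
    and S: "\<And>q. q \<in> U \<Longrightarrow> S q = sin (\<theta> q)" and C: "\<And>q. q \<in> U \<Longrightarrow> C q = cos (\<theta> q)"
    and dS: "(S has_derivative S') (at p)" and dC: "(C has_derivative C') (at p)"
  shows "(\<theta> has_derivative (\<lambda>d. C p * S' d - S p * C' d)) (at p)"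
proof -
  define h where "h q = S q * C p - C q * S p" for q
  have h_sin: "h q = sin (\<theta> q - \<theta> p)" if "q \<in> U" for q
    using that assms(2) by (simp add: h_def S C sin_diff)
  have dh: "(h has_derivative (\<lambda>d. C p * S' d - S p * C' d)) (at p)"
    unfolding h_def by (auto intro!: derivative_eq_intros dS dC simp: mult.commute)
  have h0: "h p = 0"
    by (simp add: h_def)
  have "((\<lambda>q. arcsin (h q)) has_derivative (\<lambda>d. C p * S' d - S p * C' d)) (at p)"
    using has_derivative_arcsin[OF _ _ dh] by (simp add: h0)
  then have D: "((\<lambda>q. \<theta> p + arcsin (h q)) has_derivative (\<lambda>d. C p * S' d - S p * C' d)) (at p)"
    using has_derivative_add[OF has_derivative_const] by fastforce
  define W where "W = U \<inter> (\<lambda>q. \<theta> q - \<theta> p) -` {- (pi / 2)<..<pi / 2}"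
  have "open W"
    unfolding W_def using assms(1,3)
    by (intro continuous_open_preimage continuous_intros) auto
  moreover have "p \<in> W"
    using assms(2) by (simp add: W_def)
  moreover have "\<theta> p + arcsin (h q) = \<theta> q" if "q \<in> W" for q
    using that by (simp add: W_def h_sin arcsin_sin)
  ultimately show ?thesis
    by (rule has_derivative_transform_within_open[OF D])
qed

text \<open>The derivative formula involves only the smooth pair and no longer the angle, so the
  directional derivatives of \<open>\<theta>\<close> are smooth although \<open>\<theta>\<close> is only known to be continuous.\<close>

lemma smooth_on_angle:
  fixes \<theta> S C :: "'a::euclidean_space \<Rightarrow> real"
  assumes U: "open U" and "continuous_on U \<theta>"
    and "\<And>q. q \<in> U \<Longrightarrow> S q = sin (\<theta> q)" "\<And>q. q \<in> U \<Longrightarrow> C q = cos (\<theta> q)"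
    and S: "smooth_on U S" and C: "smooth_on U C"
  shows "smooth_on U \<theta>"
proof (rule smooth_onI_derivative[OF U])
  show "(\<theta> has_derivative
      (\<lambda>d. C p * frechet_derivative S (at p) d - S p * frechet_derivative C (at p) d)) (at p)"
    if "p \<in> U" for p
    using assms that by (intro has_derivative_angle[of U] smooth_on_has_derivative) auto
  show "smooth_on U (\<lambda>p. C p * frechet_derivative S (at p) d - S p * frechet_derivative C (at p) d)"
    for d
    using U S C by (intro smooth_on_diff smooth_on_mult smooth_on_frechet_derivative)
qed

text \<open>
  An open set is locally path connected, so on a simply connected \<open>U\<close> the map \<open>C + \<i> S\<close> into the punctured
  plane lifts through the covering \<open>exp\<close>. Its modulus is \<open>1\<close>, hence the lift is purely imaginary
  and its imaginary part is the angle.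
\<close>

lemma smooth_angle_exists:
  fixes S C :: "'a::euclidean_space \<Rightarrow> real"
  assumes U: "open U" "simply_connected U"
    and S: "smooth_on U S" and C: "smooth_on U C"
    and circle: "\<And>p. p \<in> U \<Longrightarrow> (S p)\<^sup>2 + (C p)\<^sup>2 = 1"
  obtains \<theta> where "smooth_on U \<theta>" "\<And>p. p \<in> U \<Longrightarrow> sin (\<theta> p) = S p" "\<And>p. p \<in> U \<Longrightarrow> cos (\<theta> p) = C p"
proof -
  have "continuous_on U (\<lambda>p. Complex (C p) (S p))"
    unfolding Complex_eq using S C by (intro continuous_intros smooth_on_imp_continuous_on)
  moreover have norm1: "norm (Complex (C p) (S p)) = 1" if "p \<in> U" for p
    using circle[OF that] by (simp add: cmod_def add.commute)
  then have "Complex (C p) (S p) \<noteq> 0" if "p \<in> U" for p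
    using that by fastforce
  ultimately obtain l where l: "continuous_on U l" "\<And>p. p \<in> U \<Longrightarrow> Complex (C p) (S p) = exp (l p)"
    using continuous_logarithm_on_simply_connected[of U "\<lambda>p. Complex (C p) (S p)"]
      U open_imp_locally_path_connected by blast
  define \<theta> where "\<theta> p = Im (l p)" for p
  have Re0: "Re (l p) = 0" if "p \<in> U" for p
    using norm1[OF that] l(2)[OF that] by simp
  have sc: "S p = sin (\<theta> p)" "C p = cos (\<theta> p)" if "p \<in> U" for p
    using arg_cong[OF l(2)[OF that], of Im] arg_cong[OF l(2)[OF that], of Re] Re0[OF that]
    by (simp_all add: \<theta>_def Im_exp Re_exp)
  have "continuous_on U \<theta>"
    unfolding \<theta>_def using l(1) by (intro continuous_intros)
  then have "smooth_on U \<theta>"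
    using smooth_on_angle[OF U(1) _ sc S C] by blast
  then show ?thesis
    using that sc by metis
qed

section \<open>Orthonormal frames\<close>

lemma bounded_bilinear_cross3: "bounded_bilinear cross3"
  using bilinear_cross by (simp add: bilinear_conv_bounded_bilinear)

lemmas smooth_on_cross3 = smooth_on_bilinear[OF bounded_bilinear_cross3]

lemma frame_inner:
  assumes "(n, s) \<in> Delta"
  shows "n \<bullet> n = 1" "s \<bullet> s = 1" "n \<bullet> s = 0" "s \<bullet> n = 0"
    "n \<bullet> (n \<times> s) = 0" "(n \<times> s) \<bullet> n = 0" "s \<bullet> (n \<times> s) = 0" "(n \<times> s) \<bullet> s = 0"
    "(n \<times> s) \<bullet> (n \<times> s) = 1"
  using assms by (auto simp: Delta_def norm_eq_1 inner_commute dot_cross_self dot_cross)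

lemma frame_cross:
  assumes "(n, s) \<in> Delta"
  shows "(n \<times> s) \<times> n = s" "n \<times> (n \<times> s) = - s"
proof -
  show "n \<times> (n \<times> s) = - s"
    using frame_inner[OF assms] by (simp add: Lagrange)
  then show "(n \<times> s) \<times> n = s"
    using cross_skew[of "n \<times> s" n] by simp
qed

text \<open>
  Since \<open>w \<times> (n \<times> s) = - (w \<bullet> n) s\<close>, the length of this cross product supplies the component of
  \<open>w\<close> along \<open>n\<close>, complementary to that along \<open>n \<times> s\<close>.
\<close>

lemma frame_components_on_circle:
  assumes "(n, s) \<in> Delta" "norm w = 1" "w \<bullet> s = 0"
  shows "(w \<bullet> n)\<^sup>2 + (w \<bullet> (n \<times> s))\<^sup>2 = 1"
proof -
  have "norm s = 1" "norm (n \<times> s) = 1"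
    using frame_inner[OF assms(1)] by (simp_all add: norm_eq_1)
  moreover have "w \<times> (n \<times> s) = - ((w \<bullet> n) *\<^sub>R s)"
    using assms(3) by (simp add: Lagrange)
  ultimately show ?thesis
    using norm_cross_dot[of w "n \<times> s"] assms(2) by simp
qed

text \<open>Rotating the plane of \<open>n \<times> s\<close> and \<open>n\<close> fixes its oriented normal, which is \<open>(n \<times> s) \<times> n = s\<close>;
  so \<open>s\<close> becomes the third vector of the new frame.\<close>

lemma rotated_frame:
  fixes r :: real
  assumes "(n, s) \<in> Delta"
  defines "m \<equiv> cos r *\<^sub>R (n \<times> s) - sin r *\<^sub>R n"
    and "k \<equiv> cos r *\<^sub>R n + sin r *\<^sub>R (n \<times> s)"
  shows "(m, k) \<in> Delta" "m \<times> k = s"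
proof -
  note [simp] = frame_inner[OF assms(1)] frame_cross[OF assms(1)]
  have sq: "cos r * cos r + sin r * sin r = 1"
    using sin_cos_squared_add[of r] by (simp add: power2_eq_square)
  show "(m, k) \<in> Delta"
    using sq by (simp add: Delta_def m_def k_def norm_eq_1 inner_diff_left inner_diff_right
        inner_add_left inner_add_right algebra_simps)
  show "m \<times> k = s"
    by (simp add: m_def k_def Cross3.left_diff_distrib cross_add_right cross_mult_left
        cross_mult_right flip: scaleR_add_left)
qed

section \<open>Moving a framed surface along its second frame vector\<close>

text \<open>
  The coefficient of \<open>s\<close> is the only place where derivatives of \<open>lam\<close> appear, and it is invisible to
  a normal vector orthogonal to \<open>s\<close>. This is why the criterion is algebraic in \<open>lam\<close>.
\<close>

lemma partial_along_s:
  assumes U: "open U" "p \<in> U" and smooth: "smooth_on U x" "smooth_on U s" "smooth_on U lam"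
    and inv: "basic_invariants U x n s a b e f g"
    and x': "\<And>q. q \<in> U \<Longrightarrow> x' q = x q + lam q *\<^sub>R s q"
  shows "\<partial> i x' p = (a i p + \<partial> i lam p) *\<^sub>R s p
    + (b i p + lam p * g i p) *\<^sub>R tvec n s p - (lam p * e i p) *\<^sub>R n p"
proof -
  have "((\<lambda>q. x q + lam q *\<^sub>R s q) has_derivative
      (\<lambda>d. frechet_derivative x (at p) d
         + (lam p *\<^sub>R frechet_derivative s (at p) d + frechet_derivative lam (at p) d *\<^sub>R s p))) (at p)"
    using smooth U(2)
    by (intro has_derivative_add has_derivative_scaleR smooth_on_has_derivative)
  then have "(x' has_derivative
      (\<lambda>d. frechet_derivative x (at p) d
         + (lam p *\<^sub>R frechet_derivative s (at p) d + frechet_derivative lam (at p) d *\<^sub>R s p))) (at p)"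
    by (rule has_derivative_transform_within_open[OF _ U]) (simp add: x')
  from frechet_derivative_at[OF this, symmetric]
  have "\<partial> i x' p = \<partial> i x p + (lam p *\<^sub>R \<partial> i s p + \<partial> i lam p *\<^sub>R s p)"
    by (simp add: partial_def)
  moreover have "\<partial> i x p = a i p *\<^sub>R s p + b i p *\<^sub>R tvec n s p"
    "\<partial> i s p = - e i p *\<^sub>R n p + g i p *\<^sub>R tvec n s p"
    using inv U(2) by (auto simp: basic_invariants_def)
  ultimately show ?thesis
    by (simp add: algebra_simps)
qed

lemma matrix_2x2_mult_eq_0_iff:
  fixes A B C D r q :: real
  shows "(vector [vector [A, B], vector [C, D]] :: real^2^2) *v vector [r, q] = 0
    \<longleftrightarrow> A * r + B * q = 0 \<and> C * r + D * q = 0"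
  by (simp add: vec_eq_iff forall_2 matrix_vector_mult_def sum_2)

theorem theorem3p18:
  fixes U :: "(real^2) set"
    and x n s :: "real^2 \<Rightarrow> real^3"
    and a b e f g :: "2 \<Rightarrow> real^2 \<Rightarrow> real"
  assumes "open U" and "U \<noteq> {}" and "connected U" and "simply_connected U"
    and "framed_surface U x n s"
    and "basic_invariants U x n s a b e f g"
  shows "Bertrand_framed_surface U Leg_s Leg_t x n s \<longleftrightarrow>
    (\<exists>lam \<theta> :: real^2 \<Rightarrow> real.
       smooth_on U lam \<and> smooth_on U \<theta> \<and> densely_nonzero_on U lam \<and>
       (\<forall>p\<in>U.
          (vector [vector [lam p * e 1 p, b 1 p + lam p * g 1 p],
                   vector [lam p * e 2 p, b 2 p + lam p * g 2 p]] :: real^2^2)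
            *v vector [sin (\<theta> p), cos (\<theta> p)] = 0))"
  (is "?Bertrand \<longleftrightarrow> ?solution")
proof -
  note U = \<open>open U\<close> and inv = \<open>basic_invariants U x n s a b e f g\<close>
  have smooth: "smooth_on U x" "smooth_on U n" "smooth_on U s"
    and Delta: "\<And>p. p \<in> U \<Longrightarrow> (n p, s p) \<in> Delta"
    using \<open>framed_surface U x n s\<close> by (auto simp: framed_surface_def)
  have t: "tvec n s = (\<lambda>p. n p \<times> s p)"
    by (simp add: tvec_def fun_eq_iff)
  show ?thesis
  proof
    assume ?Bertrand
    then obtain x' n' s' lam where fs': "framed_surface U x' n' s'"
      and lam: "smooth_on U lam" "densely_nonzero_on U lam"
      and x': "\<And>p. p \<in> U \<Longrightarrow> x' p = x p + lam p *\<^sub>R s p"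
      and s_eq: "\<And>p. p \<in> U \<Longrightarrow> s p = n' p \<times> s' p"
      by (auto simp: Bertrand_framed_surface_def mates_def tvec_def)
    have smooth': "smooth_on U n'" and Delta': "\<And>p. p \<in> U \<Longrightarrow> (n' p, s' p) \<in> Delta"
      and normal: "\<And>p. p \<in> U \<Longrightarrow> \<partial> 1 x' p \<bullet> n' p = 0 \<and> \<partial> 2 x' p \<bullet> n' p = 0"
      using fs' by (auto simp: framed_surface_def)
    \<comment> \<open>The signs match \<open>n' = cos \<theta> t - sin \<theta> n\<close>, the form that produces the system as stated.\<close>
    define S where "S p = - (n' p \<bullet> n p)" for p
    define C where "C p = n' p \<bullet> (n p \<times> s p)" for p
    have n's: "n' p \<bullet> s p = 0" if "p \<in> U" for p
      using s_eq[OF that] by (simp add: dot_cross_self)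
    have "smooth_on U S" "smooth_on U C"
      unfolding S_def C_def using U smooth smooth'
      by (auto intro!: smooth_on_minus smooth_on_inner smooth_on_cross3)
    moreover have "(S p)\<^sup>2 + (C p)\<^sup>2 = 1" if "p \<in> U" for p
      using frame_components_on_circle[OF Delta[OF that] _ n's[OF that]]
        frame_inner(1)[OF Delta'[OF that]]
      by (simp add: S_def C_def norm_eq_1)
    ultimately obtain \<theta> where \<theta>: "smooth_on U \<theta>"
      "\<And>p. p \<in> U \<Longrightarrow> sin (\<theta> p) = S p" "\<And>p. p \<in> U \<Longrightarrow> cos (\<theta> p) = C p"
      using smooth_angle_exists[OF U \<open>simply_connected U\<close>] by metis
    have "\<partial> i x' p \<bullet> n' p = lam p * e i p * sin (\<theta> p) + (b i p + lam p * g i p) * cos (\<theta> p)"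
      if "p \<in> U" for i p
      using n's[OF that] partial_along_s[OF U that smooth(1,3) lam(1) inv x']
      by (simp add: \<theta> that S_def C_def t inner_diff_right inner_add_right
          inner_commute[of _ "n' p"])
    then show ?solution
      using lam \<theta>(1) normal
      by (intro exI[of _ lam] exI[of _ \<theta>]) (simp add: matrix_2x2_mult_eq_0_iff)
  next
    assume ?solution
    then obtain lam \<theta> where lam: "smooth_on U lam" "densely_nonzero_on U lam"
      and \<theta>: "smooth_on U \<theta>"
      and sys: "\<And>p. p \<in> U \<Longrightarrow> lam p * e 1 p * sin (\<theta> p) + (b 1 p + lam p * g 1 p) * cos (\<theta> p) = 0"
        "\<And>p. p \<in> U \<Longrightarrow> lam p * e 2 p * sin (\<theta> p) + (b 2 p + lam p * g 2 p) * cos (\<theta> p) = 0"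
      by (auto simp: matrix_2x2_mult_eq_0_iff)
    define x' where "x' p = x p + lam p *\<^sub>R s p" for p
    define n' where "n' p = cos (\<theta> p) *\<^sub>R (n p \<times> s p) - sin (\<theta> p) *\<^sub>R n p" for p
    define s' where "s' p = cos (\<theta> p) *\<^sub>R n p + sin (\<theta> p) *\<^sub>R (n p \<times> s p)" for p
    have frame': "(n' p, s' p) \<in> Delta" "n' p \<times> s' p = s p" if "p \<in> U" for p
      using rotated_frame[OF Delta[OF that], of "\<theta> p"] by (simp_all add: n'_def s'_def)
    have "smooth_on U x'" "smooth_on U n'" "smooth_on U s'"
      unfolding x'_def n'_def s'_def using U smooth lam(1) \<theta>
      by (auto intro!: smooth_on_add smooth_on_diff smooth_on_scaleR smooth_on_cross3
          smooth_on_sin smooth_on_cos)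
    moreover have "\<partial> i x' p \<bullet> n' p
        = lam p * e i p * sin (\<theta> p) + (b i p + lam p * g i p) * cos (\<theta> p)" if "p \<in> U" for i p
      using frame_inner[OF Delta[OF that]] partial_along_s[OF U that smooth(1,3) lam(1) inv x'_def]
      by (simp add: t n'_def inner_diff_left inner_diff_right inner_add_left inner_add_right)
    ultimately have "framed_surface U x' n' s'"
      using frame' sys by (simp add: framed_surface_def)
    moreover have "mates U Leg_s Leg_t x n s x' n' s'"
      unfolding mates_def using \<open>framed_surface U x n s\<close> calculation lam frame'(2)
      by (auto simp: x'_def tvec_def)
    ultimately show ?Bertrand
      by (auto simp: Bertrand_framed_surface_def)
  qed
qed

end
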